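(* Let $(\mathcal{I},N,F,\bar F)$ be a (multiplicity free) semi-simple tensor system over a commutative ring with identity $\mathbf{R}$, let $\tilde\lambda=(\lambda_1,\dots,\lambda_L)$ with $\lambda_j\in\mathcal{I}$, and let $\nu\in\mathcal{I}$. For a fixed $1\le i\le L-2$, if $\nu$ acts one-dimensionally on the left of $\lambda_{i+2}$, then as operators on $\mathcal{H}_{\tilde\lambda}$ $$p_i^{(\nu)}p_{i+1}^{(\nu')}p_i^{(\nu)}=\left(F^{\lambda_i\lambda_{i+1}\lambda_{i+2}}_{\phi^l_\nu(\lambda_{i+2})}\right)^{\nu}_{\nu'}\left(\bar F^{\lambda_i\lambda_{i+1}\lambda_{i+2}}_{\phi^l_\nu(\lambda_{i+2})}\right)^{\nu'}_{\nu}\,p_i^{(\nu)}\qquad\text{for all }\nu'\in\mathcal{I}.$$ Similarly, for a fixed $2\le i\le L-1$, if $\nu$ acts one-dimensionally on the right of $\lambda_{i-1}$, then as operators on $\mathcal{H}_{\tilde\lambda}$ $$p_i^{(\nu)}p_{i-1}^{(\nu')}p_i^{(\nu)}=\left(F^{\lambda_{i-1}\lambda_i\lambda_{i+1}}_{\phi^r_\nu(\lambda_{i-1})}\right)^{\nu'}_{\nu}\left(\bar F^{\lambda_{i-1}\lambda_i\lambda_{i+1}}_{\phi^r_\nu(\lambda_{i-1})}\right)^{\nu}_{\nu'}\,p_i^{(\nu)}\qquad\text{for all }\nu'\in\mathcal{I}.$$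
   Context: $\mathbf{R}$ is a commutative ring with identity; $\delta_x^y$ is the Kronecker delta. A (multiplicity free) semi-simple tensor system consists of a set $\mathcal{I}$ and constants $N_{ab}^c\in\{0,1\}$ and $(F^{abc}_d)^e_f,(\bar F^{abc}_d)^e_f\in\mathbf{R}$ for $a,b,c,d,e,f\in\mathcal{I}$ such that, for all values of the free indices in $\mathcal{I}$: - (N.1) $\sum_{e}N_{ab}^eN_{ec}^d=\sum_eN_{ae}^dN_{bc}^e$; - (N.2) $\sum_cN_{ab}^c<\infty$; - (F.1) if $N_{ab}^eN_{bc}^fN_{af}^dN_{ec}^d=0$ then $(F^{abc}_d)^e_f=(\bar F^{abc}_d)^f_e=0$; - (F.2) $\sum_h(F^{abc}_g)^f_h(F^{ahd}_e)^g_k(F^{bcd}_k)^h_l=(F^{fcd}_e)^g_l(F^{abl}_e)^f_k$; - (F.3) $\sum_f(F^{abc}_d)^e_f(\bar F^{abc}_d)^f_{e'}=\delta_e^{e'}N_{ab}^eN_{ec}^d$; - (F.4) $\sum_e(\bar F^{abc}_d)^{f'}_e(F^{abc}_d)^e_f=\delta_f^{f'}N_{bc}^fN_{af}^d$. No identity object or duals are required. In equations in $\mathbf{R}$, the values $0,1$ of $N_{ab}^c$ are regarded as elements of $\mathbf{R}$. For $\nu,\mu\in\mathcal{I}$: $\nu$ acts one-dimensionally on the left of $\mu$ if $\sum_{\mu'\in\mathcal{I}}N_{\nu\mu}^{\mu'}=1$; then $\phi^l_\nu(\mu)$ denotes the unique element with $N_{\nu\mu}^{\mu'}=\delta_{\phi^l_\nu(\mu)}^{\mu'}$.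 Likewise $\nu$ acts one-dimensionally on the right of $\mu$ if $\sum_{\mu'\in\mathcal{I}}N_{\mu\nu}^{\mu'}=1$; then $\phi^r_\nu(\mu)$ denotes the unique element with $N_{\mu\nu}^{\mu'}=\delta_{\phi^r_\nu(\mu)}^{\mu'}$. For $\tilde\lambda=(\lambda_1,\dots,\lambda_L)\in\mathcal{I}^L$ and a fixed finite subset $\mathcal{I}_0\subseteq\mathcal{I}$, let $\mathcal{B}_{\tilde\lambda}$ be the set of sequences $\mu=\mu_0\mu_1\cdots\mu_L$ in $\mathcal{I}$ with $\mu_0\in\mathcal{I}_0$ and $N_{\mu_{j-1}\lambda_j}^{\mu_j}=1$ for $1\le j\le L$, and let $\mathcal{H}_{\tilde\lambda}$ be the free $\mathbf{R}$-module with basis $\{|\mu\rangle:\mu\in\mathcal{B}_{\tilde\lambda}\}$ and dual basis $\langle\mu|$. For $\nu\in\mathcal{I}$ and $1\le i\le L-1$ the two-site projection operator $p_i^{(\nu)}$ on $\mathcal{H}_{\tilde\lambda}$ is defined by $$\langle\mu'|p_i^{(\nu)}|\mu\rangle=\Big[\prod_{j\ne i}\delta_{\mu_j}^{\mu_j'}\Big]\left(\bar F^{\mu_{i-1}\lambda_i\lambda_{i+1}}_{\mu_{i+1}}\right)^{\nu}_{\mu_i'}\left(F^{\mu_{i-1}\lambda_i\lambda_{i+1}}_{\mu_{i+1}}\right)^{\mu_i}_{\nu}.$$ *)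

theory Defs
  imports Main HOL.Modules "HOL-Library.Groups_Big_Fun" "HOL-Library.Poly_Mapping"
begin

definition kdelta :: "'a \<Rightarrow> 'a \<Rightarrow> 'r::zero_neq_one" where
  "kdelta x y = (if x = y then 1 else 0)"

(* The label set is the type 'i.  Argument order:
     N a b c            is  N_{ab}^c,
     F a b c d e f      is  (F^{abc}_d)^e_f,
     Fbar a b c d f e   is  (Fbar^{abc}_d)^f_e  (upper index before lower index).
   Unbounded sums are Sum_any (the sum over the support if that is finite).  By N01 and N2
   the support of every N a b is finite, and with F1 so is that of every sum below. *)

locale semisimple_tensor_system =
  fixes N :: "'i \<Rightarrow> 'i \<Rightarrow> 'i \<Rightarrow> nat"
    and F :: "'i \<Rightarrow> 'i \<Rightarrow> 'i \<Rightarrow> 'i \<Rightarrow> 'i \<Rightarrow> 'i \<Rightarrow> 'r::comm_ring_1"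
    and Fbar :: "'i \<Rightarrow> 'i \<Rightarrow> 'i \<Rightarrow> 'i \<Rightarrow> 'i \<Rightarrow> 'i \<Rightarrow> 'r"
  assumes N01: "N a b c \<in> {0, 1}"
    and N1: "(\<Sum>e. N a b e * N e c d) = (\<Sum>e. N a e d * N b c e)"
    and N2: "finite {c. N a b c \<noteq> 0}"
    and F1: "N a b e * N b c f * N a f d * N e c d = 0
               \<Longrightarrow> F a b c d e f = 0 \<and> Fbar a b c d f e = 0"
    and F2: "(\<Sum>h. F a b c g f h * F a h d e g k * F b c d k h l)
               = F f c d e g l * F a b l e f k"
    and F3: "(\<Sum>f. F a b c d e f * Fbar a b c d f e')
               = kdelta e e' * of_nat (N a b e) * of_nat (N e c d)"
    and F4: "(\<Sum>e. Fbar a b c d f' e * F a b c d e f)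
               = kdelta f f' * of_nat (N b c f) * of_nat (N a f d)"

definition acts_onedim_left :: "('i \<Rightarrow> 'i \<Rightarrow> 'i \<Rightarrow> nat) \<Rightarrow> 'i \<Rightarrow> 'i \<Rightarrow> bool" where
  "acts_onedim_left N \<nu> \<mu> \<longleftrightarrow> (\<Sum>\<mu>'. N \<nu> \<mu> \<mu>') = 1"

definition acts_onedim_right :: "('i \<Rightarrow> 'i \<Rightarrow> 'i \<Rightarrow> nat) \<Rightarrow> 'i \<Rightarrow> 'i \<Rightarrow> bool" where
  "acts_onedim_right N \<nu> \<mu> \<longleftrightarrow> (\<Sum>\<mu>'. N \<mu> \<nu> \<mu>') = 1"

(* Meaningful only when \<nu> acts one-dimensionally on the respective side of \<mu>. *)

definition phi_left :: "('i \<Rightarrow> 'i \<Rightarrow> 'i \<Rightarrow> nat) \<Rightarrow> 'i \<Rightarrow> 'i \<Rightarrow> 'i" where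
  "phi_left N \<nu> \<mu> = (THE x. \<forall>\<mu>'. N \<nu> \<mu> \<mu>' = kdelta x \<mu>')"

definition phi_right :: "('i \<Rightarrow> 'i \<Rightarrow> 'i \<Rightarrow> nat) \<Rightarrow> 'i \<Rightarrow> 'i \<Rightarrow> 'i" where
  "phi_right N \<nu> \<mu> = (THE x. \<forall>\<mu>'. N \<mu> \<nu> \<mu>' = kdelta x \<mu>')"

(* A tuple (\<lambda>_1, ..., \<lambda>_L) is a function lam on nat of which only the values at 1, ..., L
   are used.  A sequence \<mu>_0 \<mu>_1 ... \<mu>_L is a list of length L + 1, so \<mu> ! j is \<mu>_j. *)

definition path_basis ::
  "('i \<Rightarrow> 'i \<Rightarrow> 'i \<Rightarrow> nat) \<Rightarrow> 'i set \<Rightarrow> (nat \<Rightarrow> 'i) \<Rightarrow> nat \<Rightarrow> 'i list set" where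
  "path_basis N I0 lam L =
     {\<mu>. length \<mu> = Suc L \<and> \<mu> ! 0 \<in> I0 \<and>
          (\<forall>j\<in>{1..L}. N (\<mu> ! (j - 1)) (lam j) (\<mu> ! j) = 1)}"

(* The free module: the basis vector |\<mu>> is Poly_Mapping.single \<mu> 1 and the dual basis
   functional <\<mu>| is \<lambda>v. Poly_Mapping.lookup v \<mu>. *)

definition path_module ::
  "('i \<Rightarrow> 'i \<Rightarrow> 'i \<Rightarrow> nat) \<Rightarrow> 'i set \<Rightarrow> (nat \<Rightarrow> 'i) \<Rightarrow> nat \<Rightarrow> ('i list \<Rightarrow>\<^sub>0 'r::comm_ring_1) set" where
  "path_module N I0 lam L = {v. Poly_Mapping.keys v \<subseteq> path_basis N I0 lam L}"

definition scale_vec :: "'r::comm_ring_1 \<Rightarrow> ('b \<Rightarrow>\<^sub>0 'r) \<Rightarrow> ('b \<Rightarrow>\<^sub>0 'r)" where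
  "scale_vec c v = Poly_Mapping.map ((*) c) v"

(* proj_entry F Fbar lam L \<nu> i \<mu>' \<mu>  is  <\<mu>'| p_i^(\<nu>) |\<mu>>. *)

definition proj_entry ::
  "('i \<Rightarrow> 'i \<Rightarrow> 'i \<Rightarrow> 'i \<Rightarrow> 'i \<Rightarrow> 'i \<Rightarrow> 'r::comm_ring_1) \<Rightarrow>
   ('i \<Rightarrow> 'i \<Rightarrow> 'i \<Rightarrow> 'i \<Rightarrow> 'i \<Rightarrow> 'i \<Rightarrow> 'r) \<Rightarrow>
   (nat \<Rightarrow> 'i) \<Rightarrow> nat \<Rightarrow> 'i \<Rightarrow> nat \<Rightarrow> 'i list \<Rightarrow> 'i list \<Rightarrow> 'r" where
  "proj_entry F Fbar lam L \<nu> i \<mu>' \<mu> =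
     (\<Prod>j\<in>{0..L} - {i}. kdelta (\<mu> ! j) (\<mu>' ! j)) *
     Fbar (\<mu> ! (i - 1)) (lam i) (lam (i + 1)) (\<mu> ! (i + 1)) \<nu> (\<mu>' ! i) *
     F (\<mu> ! (i - 1)) (lam i) (lam (i + 1)) (\<mu> ! (i + 1)) (\<mu> ! i) \<nu>"

definition proj ::
  "('i \<Rightarrow> 'i \<Rightarrow> 'i \<Rightarrow> nat) \<Rightarrow>
   ('i \<Rightarrow> 'i \<Rightarrow> 'i \<Rightarrow> 'i \<Rightarrow> 'i \<Rightarrow> 'i \<Rightarrow> 'r::comm_ring_1) \<Rightarrow>
   ('i \<Rightarrow> 'i \<Rightarrow> 'i \<Rightarrow> 'i \<Rightarrow> 'i \<Rightarrow> 'i \<Rightarrow> 'r) \<Rightarrow>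
   'i set \<Rightarrow> (nat \<Rightarrow> 'i) \<Rightarrow> nat \<Rightarrow> 'i \<Rightarrow> nat \<Rightarrow> ('i list \<Rightarrow>\<^sub>0 'r) \<Rightarrow> ('i list \<Rightarrow>\<^sub>0 'r)" where
  "proj N F Fbar I0 lam L \<nu> i v =
     (\<Sum>\<mu>\<in>path_basis N I0 lam L. \<Sum>\<mu>'\<in>path_basis N I0 lam L.
        Poly_Mapping.single \<mu>' (proj_entry F Fbar lam L \<nu> i \<mu>' \<mu> * Poly_Mapping.lookup v \<mu>))"

lemma lookup_scale_vec: "Poly_Mapping.lookup (scale_vec c v) x = c * Poly_Mapping.lookup v x"
  by (simp add: scale_vec_def Poly_Mapping.map.rep_eq when_def)

lemma module_scale_vec: "module scale_vec"
  by unfold_locales (auto intro!: poly_mapping_eqI simp: lookup_scale_vec lookup_add algebra_simps)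

lemma subspace_path_module: "module.subspace scale_vec (path_module N I0 lam L)"
  unfolding module.subspace_def[OF module_scale_vec] path_module_def
  by (auto simp: in_keys_iff lookup_add lookup_scale_vec subset_iff)
    (metis add.right_neutral, metis mult_zero_right)

(* For infinite path_basis the sums defining proj would be void; this does not occur. *)

lemma finite_path_basis:
  assumes fin: "\<And>a b. finite {c. N a b c \<noteq> 0}" and I0: "finite I0"
  shows "finite (path_basis N I0 lam L)"
proof (induction L)
  case 0
  have "path_basis N I0 lam 0 \<subseteq> (\<lambda>x. [x]) ` I0"
    by (auto simp: path_basis_def length_Suc_conv)
  then show ?case
    using I0 finite_surj by blast
next
  case (Suc L)
  let ?S = "\<Union>\<mu>\<in>path_basis N I0 lam L.
    (\<lambda>x. \<mu> @ [x]) ` {c. N (\<mu> ! L) (lam (Suc L)) c \<noteq> 0}"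
  have "path_basis N I0 lam (Suc L) \<subseteq> ?S"
  proof
    fix \<mu> assume "\<mu> \<in> path_basis N I0 lam (Suc L)"
    then have len: "length \<mu> = Suc (Suc L)" and hd: "\<mu> ! 0 \<in> I0"
      and st: "\<And>j. j \<in> {1..Suc L} \<Longrightarrow> N (\<mu> ! (j - 1)) (lam j) (\<mu> ! j) = 1"
      by (auto simp: path_basis_def)
    obtain xs x where \<mu>: "\<mu> = xs @ [x]"
      using len by (metis length_Suc_conv_rev)
    have lx: "length xs = Suc L" using len \<mu> by simp
    have "N (xs ! (j - 1)) (lam j) (xs ! j) = 1" if "j \<in> {1..L}" for j
      using st[of j] that lx by (auto simp: \<mu> nth_append split: if_splits)
    then have "xs \<in> path_basis N I0 lam L"
      using hd lx by (auto simp: path_basis_def \<mu> nth_append)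
    moreover have "N (xs ! L) (lam (Suc L)) x \<noteq> 0"
      using st[of "Suc L"] lx by (auto simp: \<mu> nth_append)
    ultimately show "\<mu> \<in> ?S" using \<mu> by blast
  qed
  moreover have "finite ?S" using Suc fin by blast
  ultimately show ?case by (rule finite_subset)
qed

lemma lookup_proj_single:
  assumes "finite (path_basis N I0 lam L)"
    and "\<mu> \<in> path_basis N I0 lam L" and "\<mu>' \<in> path_basis N I0 lam L"
  shows "Poly_Mapping.lookup (proj N F Fbar I0 lam L \<nu> i (Poly_Mapping.single \<mu> 1)) \<mu>'
         = proj_entry F Fbar lam L \<nu> i \<mu>' \<mu>"
proof -
  have "Poly_Mapping.lookup (proj N F Fbar I0 lam L \<nu> i (Poly_Mapping.single \<mu> 1)) \<mu>'
      = (\<Sum>x\<in>path_basis N I0 lam L. if x = \<mu> then proj_entry F Fbar lam L \<nu> i \<mu>' \<mu> else 0)"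
    unfolding proj_def lookup_sum
    using assms by (intro sum.cong refl) (auto simp: lookup_single when_def)
  then show ?thesis using assms by simp
qed

lemma module_hom_proj: "module_hom scale_vec scale_vec (proj N F Fbar I0 lam L \<nu> i)"
  unfolding module_hom_def module_hom_axioms_def
  by (auto intro!: module_scale_vec poly_mapping_eqI sum.cong
      simp: proj_def lookup_scale_vec lookup_add lookup_sum lookup_single when_def
        sum.distrib[symmetric] sum_distrib_left algebra_simps)

lemma proj_in_path_module: "proj N F Fbar I0 lam L \<nu> i v \<in> path_module N I0 lam L"
  unfolding proj_def
  by (intro module.subspace_sum[OF module_scale_vec] subspace_path_module)
    (auto simp: path_module_def)

end

theory Submission
  imports Defs
begin

text \<open>
  On a path segment \<open>a, f, g, e\<close> with steps \<open>b, c, d\<close>, the two neighbouring projections change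
  only \<open>f\<close> and \<open>g\<close>. Moving factors of the pentagon relation (F.2) across by (F.3) and (F.4)
  yields two relations expressing a product \<open>Fbar * F\<close> as a sum of triple products over a label
  \<open>k\<close>, which lies in \<open>\<nu> \<otimes> d\<close> for \<open>j = i + 1\<close> and in \<open>b \<otimes> \<nu>\<close> for \<open>j = i - 1\<close>. Their product turns the closed
  loop in \<open>p\<^sub>i p\<^sub>j p\<^sub>i\<close> into a sum over a single \<open>k\<close>. One-dimensionality leaves only one \<open>k\<close>, so
  the scalar factors out; by associativity (N.1) it also forces the middle projection to act
  diagonally between the two outer ones.
\<close>

section \<open>Preliminaries on finite sums and coordinates\<close>

lemma prod_kdelta:
  assumes "finite A"
  shows "(\<Prod>j\<in>A. kdelta (f j) (g j)) = (if \<forall>j\<in>A. f j = g j then 1 else (0::'r::comm_ring_1))"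
proof (cases "\<forall>j\<in>A. f j = g j")
  case True
  then show ?thesis by (auto simp: kdelta_def)
next
  case False
  then show ?thesis
    using assms by (auto simp: kdelta_def intro!: prod_zero)
qed

text \<open>Allowing \<open>x0\<close> outside \<open>A\<close> spares membership proofs: in the
  applications the vanishing of inadmissible entries settles that case.\<close>

lemma sum_eq_single:
  assumes "finite A" and "\<And>x. x \<in> A \<Longrightarrow> x \<noteq> x0 \<Longrightarrow> f x = 0" and "x0 \<notin> A \<Longrightarrow> f x0 = 0"
  shows "sum f A = f x0"
proof -
  have "sum f A = (\<Sum>x\<in>A. if x = x0 then f x0 else 0)"
    using assms(2) by (intro sum.cong) auto
  then show ?thesis using assms(1,3) by auto
qed

lemma lookup_path_module_eq_0:
  assumes "v \<in> path_module N I0 lam L" and "\<mu> \<notin> path_basis N I0 lam L"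
  shows "Poly_Mapping.lookup v \<mu> = 0"
  using assms by (auto simp: path_module_def in_keys_iff)

context semisimple_tensor_system
begin

section \<open>Fusion channels and the axioms as finite sums\<close>

text \<open>As multiplicities are 0 or 1, these finite sets carry all the information in
  \<open>N\<close>. They serve as index sets in place of the unbounded sums.\<close>

definition chan :: "'i \<Rightarrow> 'i \<Rightarrow> 'i set" where
  "chan a b = {c. N a b c \<noteq> 0}"

lemma finite_chan [simp]: "finite (chan a b)"
  unfolding chan_def by (rule N2)

lemma N_eq_chan: "N a b c = (if c \<in> chan a b then 1 else 0)"
  using N01[of a b c] by (auto simp: chan_def)

text \<open>The product condition of (F.1), split into one rewrite rule per vertex so that the
  simplifier can discard inadmissible terms.\<close>

lemma F_eq_0 [simp]:
  "e \<notin> chan a b \<Longrightarrow> F a b c d e f = 0" "f \<notin> chan b c \<Longrightarrow> F a b c d e f = 0"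
  "d \<notin> chan a f \<Longrightarrow> F a b c d e f = 0" "d \<notin> chan e c \<Longrightarrow> F a b c d e f = 0"
  using F1[of a b e c f d] by (auto simp: chan_def)

lemma Fbar_eq_0 [simp]:
  "e \<notin> chan a b \<Longrightarrow> Fbar a b c d f e = 0" "f \<notin> chan b c \<Longrightarrow> Fbar a b c d f e = 0"
  "d \<notin> chan a f \<Longrightarrow> Fbar a b c d f e = 0" "d \<notin> chan e c \<Longrightarrow> Fbar a b c d f e = 0"
  using F1[of a b e c f d] by (auto simp: chan_def)

lemma F_neq_0D:
  "F a b c d e f \<noteq> 0 \<Longrightarrow> e \<in> chan a b \<and> f \<in> chan b c \<and> d \<in> chan a f \<and> d \<in> chan e c"
  by (intro conjI; rule ccontr; simp)

lemma Fbar_neq_0D: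
  "Fbar a b c d f e \<noteq> 0 \<Longrightarrow> e \<in> chan a b \<and> f \<in> chan b c \<and> d \<in> chan a f \<and> d \<in> chan e c"
  by (intro conjI; rule ccontr; simp)

lemma Sum_any_eq_sum:
  assumes "finite A" and "\<And>x. x \<notin> A \<Longrightarrow> f x = 0"
  shows "Sum_any f = sum f A"
  using assms by (intro Sum_any.expand_superset) auto

lemma pentagon:
  "(\<Sum>h\<in>chan b c. F a b c g f h * F a h d e g k * F b c d k h l)
    = F f c d e g l * F a b l e f k"
  using F2[of a b c g f d e k l] by (subst (asm) Sum_any_eq_sum[of "chan b c"]) auto

lemma F_Fbar:
  "(\<Sum>f\<in>chan b c. F a b c d e f * Fbar a b c d f e')
    = (if e = e' \<and> e \<in> chan a b \<and> d \<in> chan e c then 1 else 0)"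
  using F3[of a b c d e e']
  by (subst (asm) Sum_any_eq_sum[of "chan b c"]) (auto simp: kdelta_def N_eq_chan)

lemma Fbar_F:
  "(\<Sum>e\<in>chan a b. Fbar a b c d f' e * F a b c d e f)
    = (if f = f' \<and> f \<in> chan b c \<and> d \<in> chan a f then 1 else 0)"
  using F4[of a b c d f' f]
  by (subst (asm) Sum_any_eq_sum[of "chan a b"]) (auto simp: kdelta_def N_eq_chan)

section \<open>Rearranged pentagon relations\<close>

text \<open>Made for \<open>z\<close> an indicator from \<open>F_Fbar\<close> or
  \<open>Fbar_F\<close>: its admissibility conditions need checking only where the coefficient
  \<open>y x0\<close> is nonzero, and there they follow from (F.1).\<close>

lemma sum_mult_delta:
  fixes y :: "'x \<Rightarrow> 's::comm_ring_1"
  assumes "finite A" and "\<And>x. x \<in> A \<Longrightarrow> x \<noteq> x0 \<Longrightarrow> z x = 0" and "x0 \<notin> A \<Longrightarrow> y x0 = 0"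
    and "y x0 \<noteq> 0 \<Longrightarrow> z x0 = 1"
  shows "(\<Sum>x\<in>A. y x * z x) = y x0"
proof -
  have "(\<Sum>x\<in>A. y x * z x) = y x0 * z x0"
    using assms by (intro sum_eq_single) auto
  then show ?thesis
    using assms(4) by (cases "y x0 = 0") auto
qed

text \<open>Two inversions of the pentagon: summing over \<open>f\<close> against
  \<open>Fbar a b c g h f\<close> removes the first factor of the triple product
  (\<open>half\<close>), and summing over \<open>k\<close> against \<open>Fbar a b l e k f\<close>
  then isolates the wanted product.\<close>

lemma Fbar_mult_F:
  "Fbar a b c g h f * F f c d e g l
    = (\<Sum>k\<in>chan h d. F a h d e g k * F b c d k h l * Fbar a b l e k f)"
proof -
  have half: "(\<Sum>f\<in>chan a b. Fbar a b c g h f * F f c d e g l * F a b l e f k)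
      = F a h d e g k * F b c d k h l" (is "?lhs k = ?rhs k") for k
  proof -
    have "?lhs k = (\<Sum>f\<in>chan a b. Fbar a b c g h f *
        (\<Sum>h'\<in>chan b c. F a b c g f h' * F a h' d e g k * F b c d k h' l))"
      unfolding pentagon by (simp add: mult.assoc)
    also have "\<dots> = (\<Sum>h'\<in>chan b c. F a h' d e g k * F b c d k h' l *
        (\<Sum>f\<in>chan a b. Fbar a b c g h f * F a b c g f h'))"
      unfolding sum_distrib_left by (subst sum.swap) (simp add: ac_simps)
    also have "\<dots> = ?rhs k"
      unfolding Fbar_F
      by (rule sum_mult_delta) (auto dest!: mult_not_zero F_neq_0D Fbar_neq_0D)
    finally show ?thesis .
  qed
  \<comment> \<open>The factor \<open>F b c d k h l\<close> vanishes unless \<open>k\<close> lies in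
    both index sets; \<open>F_Fbar\<close> requires the second one.\<close>
  have "(\<Sum>k\<in>chan h d. ?rhs k * Fbar a b l e k f) = (\<Sum>k\<in>chan b l. ?rhs k * Fbar a b l e k f)"
    by (rule sum.mono_neutral_cong)
      auto
  also have "\<dots> = (\<Sum>k\<in>chan b l. (\<Sum>f'\<in>chan a b. Fbar a b c g h f' * F f' c d e g l * F a b l e f' k)
      * Fbar a b l e k f)"
    by (simp add: half)
  also have "\<dots> = (\<Sum>f'\<in>chan a b. Fbar a b c g h f' * F f' c d e g l *
      (\<Sum>k\<in>chan b l. F a b l e f' k * Fbar a b l e k f))"
    unfolding sum_distrib_left sum_distrib_right by (subst sum.swap) (simp add: ac_simps)
  also have "\<dots> = Fbar a b c g h f * F f c d e g l"
    unfolding F_Fbar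
    by (rule sum_mult_delta) (auto dest!: mult_not_zero F_neq_0D Fbar_neq_0D)
  finally show ?thesis by simp
qed

text \<open>The companion relation takes three inversions of the pentagon: over \<open>g\<close> to
  strip its right side (\<open>half1\<close>), over \<open>l'\<close> to move
  \<open>F b c d k h l'\<close> across (\<open>half2\<close>), and over \<open>k\<close> to remove
  the last factor.\<close>

lemma Fbar_mult_F':
  "Fbar f c d e l g * F a b c g f h
    = (\<Sum>k\<in>chan h d. F a b l e f k * Fbar b c d k l h * Fbar a h d e k g)"
proof -
  \<comment> \<open>Of the conditions in \<open>Fbar_F\<close>, a nonzero
    \<open>F a b l' e f k\<close> supplies only \<open>e \<in> chan f l'\<close>; the other one,
    \<open>l' \<in> chan c d\<close>, has to be assumed.\<close>
  have half1: "(\<Sum>g\<in>chan f c. Fbar f c d e l g *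
        (\<Sum>h\<in>chan b c. F a b c g f h * F a h d e g k * F b c d k h l'))
      = (if l = l' then F a b l e f k else 0)" if "l' \<in> chan c d" for k l'
  proof -
    have "(\<Sum>g\<in>chan f c. Fbar f c d e l g *
        (\<Sum>h\<in>chan b c. F a b c g f h * F a h d e g k * F b c d k h l'))
      = F a b l' e f k * (\<Sum>g\<in>chan f c. Fbar f c d e l g * F f c d e g l')"
      unfolding pentagon sum_distrib_left by (simp add: ac_simps)
    then show ?thesis
      using that unfolding Fbar_F by (cases "F a b l' e f k = 0") (auto dest!: F_neq_0D)
  qed
  have half2: "(\<Sum>g\<in>chan f c. Fbar f c d e l g * F a b c g f h * F a h d e g k)
      = F a b l e f k * Fbar b c d k l h" (is "?lhs k = ?rhs k") for k
  proof -
    \<comment> \<open>A delta in \<open>l'\<close> is inserted so that \<open>half1\<close>, read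
      backwards, can replace it by the triple product.\<close>
    have "?rhs k = (\<Sum>l'\<in>chan c d. (if l = l' then F a b l e f k else 0) * Fbar b c d k l' h)"
      by (auto simp: if_distribR if_distrib[of "\<lambda>x. x * _"] cong: if_cong)
    also have "\<dots> = (\<Sum>l'\<in>chan c d. (\<Sum>g\<in>chan f c. Fbar f c d e l g *
        (\<Sum>h'\<in>chan b c. F a b c g f h' * F a h' d e g k * F b c d k h' l')) * Fbar b c d k l' h)"
      using half1 by (intro sum.cong) simp_all
    also have "\<dots> = (\<Sum>g\<in>chan f c. Fbar f c d e l g *
        (\<Sum>h'\<in>chan b c. \<Sum>l'\<in>chan c d. F a b c g f h' * F a h' d e g k *
          (F b c d k h' l' * Fbar b c d k l' h)))"
      unfolding sum_distrib_left sum_distrib_right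
      by (subst sum.swap, rule sum.cong[OF refl], subst sum.swap) (simp add: ac_simps)
    also have "\<dots> = ?lhs k"
    proof (intro sum.cong refl)
      fix g
      have "(\<Sum>h'\<in>chan b c. (F a b c g f h' * F a h' d e g k) *
          (\<Sum>l'\<in>chan c d. F b c d k h' l' * Fbar b c d k l' h)) = F a b c g f h * F a h d e g k"
        unfolding F_Fbar
        by (rule sum_mult_delta) (auto dest!: mult_not_zero F_neq_0D Fbar_neq_0D)
      then show "Fbar f c d e l g *
        (\<Sum>h'\<in>chan b c. \<Sum>l'\<in>chan c d. F a b c g f h' * F a h' d e g k *
          (F b c d k h' l' * Fbar b c d k l' h)) = Fbar f c d e l g * F a b c g f h * F a h d e g k"
        by (simp add: sum_distrib_left mult.assoc)
    qed
    finally show ?thesis by simp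
  qed
  have "(\<Sum>k\<in>chan h d. ?rhs k * Fbar a h d e k g)
      = (\<Sum>k\<in>chan h d. (\<Sum>g'\<in>chan f c. Fbar f c d e l g' * F a b c g' f h * F a h d e g' k)
          * Fbar a h d e k g)"
    by (simp add: half2)
  also have "\<dots> = (\<Sum>g'\<in>chan f c. Fbar f c d e l g' * F a b c g' f h *
      (\<Sum>k\<in>chan h d. F a h d e g' k * Fbar a h d e k g))"
    unfolding sum_distrib_left sum_distrib_right by (subst sum.swap) (simp add: ac_simps)
  also have "\<dots> = Fbar f c d e l g * F a b c g f h"
    unfolding F_Fbar
    by (rule sum_mult_delta) (auto dest!: mult_not_zero F_neq_0D Fbar_neq_0D)
  finally show ?thesis by simp
qed

section \<open>One-dimensional actions and uniqueness of intermediate labels\<close>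

lemma chan_onedim_left:
  assumes "acts_onedim_left N \<nu> d"
  shows "chan \<nu> d = {phi_left N \<nu> d}"
proof -
  have "(\<Sum>k\<in>chan \<nu> d. N \<nu> d k) = 1"
    using assms unfolding acts_onedim_left_def chan_def Sum_any.expand_set .
  then have "card (chan \<nu> d) = 1"
    by (simp add: N_eq_chan)
  then obtain x where x: "chan \<nu> d = {x}"
    by (auto simp: card_1_singleton_iff)
  have "phi_left N \<nu> d = x"
    unfolding phi_left_def N_eq_chan x
    by (rule the_equality) (auto simp: kdelta_def split: if_splits)
  with x show ?thesis by simp
qed

text \<open>This is the left version with the two labels exchanged, since the right-hand notions
  unfold to the left-hand ones with swapped arguments.\<close>

lemma chan_onedim_right:
  assumes "acts_onedim_right N \<nu> b"
  shows "chan b \<nu> = {phi_right N \<nu> b}"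
  using assms chan_onedim_left[of b \<nu>]
  unfolding acts_onedim_left_def acts_onedim_right_def phi_left_def phi_right_def by simp

text \<open>With multiplicities 0 or 1, each side of (N.1) counts the admissible intermediate labels
  of one bracketing.\<close>

lemma card_assoc:
  "card {g \<in> chan a b. e \<in> chan g c} = card {k \<in> chan b c. e \<in> chan a k}"
proof -
  have "(\<Sum>g. N a b g * N g c e) = card {g \<in> chan a b. e \<in> chan g c}"
    by (subst Sum_any_eq_sum[of "chan a b"])
      (auto simp: N_eq_chan sum.If_cases Int_def if_distrib cong: if_cong)
  moreover have "(\<Sum>k. N b c k * N a k e) = card {k \<in> chan b c. e \<in> chan a k}"
    by (subst Sum_any_eq_sum[of "chan b c"])
      (auto simp: N_eq_chan sum.If_cases Int_def if_distrib cong: if_cong)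
  ultimately show ?thesis using N1[of a b c e] by (simp add: mult.commute)
qed

text \<open>The other bracketing has at most the one intermediate label \<open>k\<close>, so
  \<open>card_assoc\<close> leaves room for at most one here.\<close>

lemma middle_unique:
  assumes "chan b c = {k}"
    and "g \<in> chan a b" "e \<in> chan g c" "g' \<in> chan a b" "e \<in> chan g' c"
  shows "g = g'"
proof -
  have "card {k \<in> chan b c. e \<in> chan a k} \<le> card {k}"
    using assms(1) by (intro card_mono) auto
  then have "card {g \<in> chan a b. e \<in> chan g c} \<le> Suc 0"
    by (simp add: card_assoc)
  moreover have "finite {g \<in> chan a b. e \<in> chan g c}" by simp
  ultimately show ?thesis
    using assms(2-) by (simp only: card_le_Suc0_iff_eq) blast
qed

section \<open>Evaluation of the closed loops\<close>

text \<open>Both rearranged pentagons have a single term, \<open>k = \<phi>\<close>. Of their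
  product, the factors depending on \<open>f\<close> sum to an indicator by \<open>Fbar_F\<close>,
  and the pair \<open>F a \<nu> d e g \<phi>\<close>, \<open>Fbar a \<nu> d e \<phi> g\<close>
  cancels because \<open>F_Fbar\<close> has only one summand.\<close>

lemma loop_left:
  assumes chan: "chan \<nu> d = {\<phi>}" and g: "g \<in> chan a \<nu>" and e: "e \<in> chan g d"
  shows "(\<Sum>f\<in>chan a b. (F a b c g f \<nu> * Fbar f c d e \<nu>' g) * (F f c d e g \<nu>' * Fbar a b c g \<nu> f))
    = F b c d \<phi> \<nu> \<nu>' * Fbar b c d \<phi> \<nu>' \<nu>"
proof -
  have one: "F a \<nu> d e g \<phi> * Fbar a \<nu> d e \<phi> g = 1"
    using F_Fbar[of a \<nu> d e g g] g e by (simp add: chan)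
  have "(\<Sum>f\<in>chan a b. (F a b c g f \<nu> * Fbar f c d e \<nu>' g) * (F f c d e g \<nu>' * Fbar a b c g \<nu> f))
      = (\<Sum>f\<in>chan a b. (Fbar a b c g \<nu> f * F f c d e g \<nu>') * (Fbar f c d e \<nu>' g * F a b c g f \<nu>))"
    by (simp add: ac_simps)
  also have "\<dots> = F b c d \<phi> \<nu> \<nu>' * Fbar b c d \<phi> \<nu>' \<nu> * (F a \<nu> d e g \<phi> * Fbar a \<nu> d e \<phi> g) *
      (\<Sum>f\<in>chan a b. Fbar a b \<nu>' e \<phi> f * F a b \<nu>' e f \<phi>)"
    unfolding Fbar_mult_F Fbar_mult_F' chan by (simp add: sum_distrib_left ac_simps)
  also have "\<dots> = F b c d \<phi> \<nu> \<nu>' * Fbar b c d \<phi> \<nu>' \<nu> *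
      (if \<phi> \<in> chan b \<nu>' \<and> e \<in> chan a \<phi> then 1 else 0)"
    unfolding Fbar_F one by simp
  \<comment> \<open>The indicator is redundant: \<open>one\<close> gives
    \<open>e \<in> chan a \<phi>\<close>, and where \<open>\<phi> \<notin> chan b \<nu>'\<close> the
    coefficient is already zero.\<close>
  also have "\<dots> = F b c d \<phi> \<nu> \<nu>' * Fbar b c d \<phi> \<nu>' \<nu>"
  proof -
    have "F a \<nu> d e g \<phi> \<noteq> 0" using one by auto
    then show ?thesis by (auto dest!: F_neq_0D)
  qed
  finally show ?thesis .
qed

lemma loop_right:
  assumes chan: "chan b \<nu> = {\<phi>}" and f: "f \<in> chan a b" and e: "e \<in> chan f \<nu>"
  shows "(\<Sum>g\<in>chan f c. (F f c d e g \<nu> * Fbar a b c g \<nu>' f) * (F a b c g f \<nu>' * Fbar f c d e \<nu> g))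
    = F b c d \<phi> \<nu>' \<nu> * Fbar b c d \<phi> \<nu> \<nu>'"
proof -
  have one: "F a b \<nu> e f \<phi> * Fbar a b \<nu> e \<phi> f = 1"
    using F_Fbar[of a b \<nu> e f f] f e by (simp add: chan)
  \<comment> \<open>Here the sum runs over \<open>chan \<nu>' d\<close>, which need not be a
    singleton; the factor \<open>F b c d k \<nu>' \<nu>\<close> restricts it to
    \<open>chan b \<nu>\<close>, hence to \<open>\<phi>\<close>.\<close>
  have 1: "Fbar a b c g \<nu>' f * F f c d e g \<nu>
      = F a \<nu>' d e g \<phi> * F b c d \<phi> \<nu>' \<nu> * Fbar a b \<nu> e \<phi> f" for g
    unfolding Fbar_mult_F by (rule sum_eq_single) (auto simp: chan)
  have 2: "Fbar f c d e \<nu> g * F a b c g f \<nu>'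
      = F a b \<nu> e f \<phi> * Fbar b c d \<phi> \<nu> \<nu>' * Fbar a \<nu>' d e \<phi> g" for g
    unfolding Fbar_mult_F' by (rule sum_eq_single) (auto simp: chan)
  have "(\<Sum>g\<in>chan f c. (F f c d e g \<nu> * Fbar a b c g \<nu>' f) * (F a b c g f \<nu>' * Fbar f c d e \<nu> g))
      = (\<Sum>g\<in>chan f c. (Fbar a b c g \<nu>' f * F f c d e g \<nu>) * (Fbar f c d e \<nu> g * F a b c g f \<nu>'))"
    by (simp add: ac_simps)
  \<comment> \<open>The summand vanishes unless \<open>g\<close> lies in both index sets;
    \<open>Fbar_F\<close> below needs \<open>chan a \<nu>'\<close>.\<close>
  also have "\<dots> = (\<Sum>g\<in>chan a \<nu>'. (Fbar a b c g \<nu>' f * F f c d e g \<nu>) * (Fbar f c d e \<nu> g * F a b c g f \<nu>'))"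
    by (rule sum.mono_neutral_cong) auto
  also have "\<dots> = F b c d \<phi> \<nu>' \<nu> * Fbar b c d \<phi> \<nu> \<nu>' * (F a b \<nu> e f \<phi> * Fbar a b \<nu> e \<phi> f) *
      (\<Sum>g\<in>chan a \<nu>'. Fbar a \<nu>' d e \<phi> g * F a \<nu>' d e g \<phi>)"
    unfolding 1 2 by (simp add: sum_distrib_left ac_simps)
  also have "\<dots> = F b c d \<phi> \<nu>' \<nu> * Fbar b c d \<phi> \<nu> \<nu>' *
      (if \<phi> \<in> chan \<nu>' d \<and> e \<in> chan a \<phi> then 1 else 0)"
    unfolding Fbar_F one by simp
  also have "\<dots> = F b c d \<phi> \<nu>' \<nu> * Fbar b c d \<phi> \<nu> \<nu>'"
  proof -
    have "F a b \<nu> e f \<phi> \<noteq> 0" using one by auto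
    then show ?thesis by (auto dest!: F_neq_0D)
  qed
  finally show ?thesis .
qed

section \<open>Coordinates of the projections on the path module\<close>

lemma path_basis_iff:
  "\<mu> \<in> path_basis N I0 lam L \<longleftrightarrow> length \<mu> = Suc L \<and> \<mu> ! 0 \<in> I0 \<and>
    (\<forall>j\<in>{1..L}. \<mu> ! j \<in> chan (\<mu> ! (j - 1)) (lam j))"
  by (auto simp: path_basis_def N_eq_chan split: if_splits)

text \<open>Only the two steps adjacent to site \<open>i\<close> involve its label, so all others
  are inherited from the modified path.\<close>

lemma path_basis_list_updateD:
  assumes "\<mu>[i := x] \<in> path_basis N I0 lam L" and "1 \<le> i"
    and "\<mu> ! i \<in> chan (\<mu> ! (i - 1)) (lam i)" and "\<mu> ! (i + 1) \<in> chan (\<mu> ! i) (lam (i + 1))"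
  shows "\<mu> \<in> path_basis N I0 lam L"
proof -
  have len: "length \<mu> = Suc L" and hd: "\<mu> ! 0 \<in> I0"
    and st: "\<And>j. j \<in> {1..L} \<Longrightarrow> \<mu>[i := x] ! j \<in> chan (\<mu>[i := x] ! (j - 1)) (lam j)"
    using assms(1,2) by (auto simp: path_basis_iff)
  have "\<mu> ! j \<in> chan (\<mu> ! (j - 1)) (lam j)" if "j \<in> {1..L}" for j
  proof -
    consider "j = i" | "j = i + 1" | "j \<noteq> i" "j - 1 \<noteq> i"
      using that by fastforce
    then show ?thesis
      using assms(3,4) st[OF that] by cases auto
  qed
  with len hd show ?thesis by (simp add: path_basis_iff)
qed

text \<open>The deltas leave only paths that differ from \<open>\<mu>\<close> at site
  \<open>i\<close>. The formula covers every list \<open>\<mu>\<close>, also outside the basis, so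
  nested projections can be rewritten without checking that updated lists are paths.\<close>

lemma lookup_proj:
  assumes "finite I0" and v: "v \<in> path_module N I0 lam L" and i: "1 \<le> i" "i + 1 \<le> L"
  shows "Poly_Mapping.lookup (proj N F Fbar I0 lam L \<nu> i v) \<mu>
    = (\<Sum>x\<in>chan (\<mu> ! (i - 1)) (lam i).
        Fbar (\<mu> ! (i - 1)) (lam i) (lam (i + 1)) (\<mu> ! (i + 1)) \<nu> (\<mu> ! i) *
        (F (\<mu> ! (i - 1)) (lam i) (lam (i + 1)) (\<mu> ! (i + 1)) x \<nu> *
         Poly_Mapping.lookup v (\<mu>[i := x])))" (is "_ = sum ?t ?C")
proof (cases "\<mu> \<in> path_basis N I0 lam L")
  case False
  \<comment> \<open>Either the updated list is no path and \<open>v\<close> vanishes there, or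
    \<open>\<mu>\<close> itself fails at a step next to site \<open>i\<close> and
    \<open>Fbar\<close> vanishes.\<close>
  have "?t x = 0" for x
  proof (cases "\<mu>[i := x] \<in> path_basis N I0 lam L")
    case True
    then have "\<mu> ! i \<notin> ?C \<or> \<mu> ! (i + 1) \<notin> chan (\<mu> ! i) (lam (i + 1))"
      using path_basis_list_updateD False i by blast
    then show ?thesis by auto
  qed (simp add: lookup_path_module_eq_0[OF v])
  then show ?thesis
    using False by (simp add: lookup_path_module_eq_0[OF proj_in_path_module])
next
  case True
  have fin: "finite (path_basis N I0 lam L)"
    using finite_path_basis N2 assms(1) .
  have len: "length \<mu> = Suc L"
    using True by (simp add: path_basis_iff)
  have inj: "inj_on (\<lambda>x. \<mu>[i := x]) ?C"
    using len i by (intro inj_onI) (metis Suc_eq_plus1 less_Suc_eq_le nth_list_update_eq le_trans le_add1)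
  have "Poly_Mapping.lookup (proj N F Fbar I0 lam L \<nu> i v) \<mu>
      = (\<Sum>\<rho>\<in>path_basis N I0 lam L. proj_entry F Fbar lam L \<nu> i \<mu> \<rho> * Poly_Mapping.lookup v \<rho>)"
    unfolding proj_def lookup_sum using fin True
    by (intro sum.cong refl) (simp add: lookup_single when_def)
  also have "\<dots> = (\<Sum>\<rho>\<in>(\<lambda>x. \<mu>[i := x]) ` ?C.
      proj_entry F Fbar lam L \<nu> i \<mu> \<rho> * Poly_Mapping.lookup v \<rho>)"
  proof (rule sum.mono_neutral_cong)
    show "proj_entry F Fbar lam L \<nu> i \<mu> \<rho> * Poly_Mapping.lookup v \<rho> = 0"
      if \<rho>: "\<rho> \<in> path_basis N I0 lam L - (\<lambda>x. \<mu>[i := x]) ` ?C" for \<rho>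
    proof (cases "\<forall>j\<in>{0..L} - {i}. \<rho> ! j = \<mu> ! j")
      case True
      have "length \<rho> = Suc L" and "\<rho> ! i \<in> chan (\<rho> ! (i - 1)) (lam i)"
        using \<rho> i by (auto simp: path_basis_iff)
      moreover from this have "\<rho> = \<mu>[i := \<rho> ! i]"
        using True len i by (intro nth_equalityI) (auto simp: nth_list_update)
      moreover have "\<rho> ! (i - 1) = \<mu> ! (i - 1)"
        using True i by auto
      ultimately show ?thesis using \<rho> by auto
    next
      case False
      then show ?thesis by (auto simp: proj_entry_def prod_kdelta)
    qed
  qed (use fin lookup_path_module_eq_0[OF v] in auto)
  also have "\<dots> = sum ?t ?C"
    unfolding sum.reindex[OF inj] o_def
  proof (rule sum.cong[OF refl])
    fix x
    have "\<forall>j\<in>{0..L} - {i}. \<mu>[i := x] ! j = \<mu> ! j" by auto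
    then show "proj_entry F Fbar lam L \<nu> i \<mu> (\<mu>[i := x]) * Poly_Mapping.lookup v (\<mu>[i := x]) = ?t x"
      using len i by (simp add: proj_entry_def prod_kdelta mult.assoc)
  qed
  finally show ?thesis .
qed

section \<open>The two operator identities\<close>

lemma proj_left:
  assumes "finite I0" and v: "v \<in> path_module N I0 lam L" and i: "1 \<le> i" "i + 2 \<le> L"
    and chan: "chan \<nu> (lam (i + 2)) = {\<phi>}"
  shows "proj N F Fbar I0 lam L \<nu> i (proj N F Fbar I0 lam L \<nu>' (i + 1) (proj N F Fbar I0 lam L \<nu> i v))
    = scale_vec (F (lam i) (lam (i + 1)) (lam (i + 2)) \<phi> \<nu> \<nu>' *
        Fbar (lam i) (lam (i + 1)) (lam (i + 2)) \<phi> \<nu>' \<nu>) (proj N F Fbar I0 lam L \<nu> i v)"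
    (is "?lhs = scale_vec ?\<kappa> ?pv")
proof (rule poly_mapping_eqI)
  fix \<mu>
  show "Poly_Mapping.lookup ?lhs \<mu> = Poly_Mapping.lookup (scale_vec ?\<kappa> ?pv) \<mu>"
  proof (cases "\<mu> \<in> path_basis N I0 lam L")
    case False
    then show ?thesis
      by (simp add: lookup_scale_vec lookup_path_module_eq_0[OF proj_in_path_module])
  next
    case True
    define a f g e where "a = \<mu> ! (i - 1)" and "f = \<mu> ! i" and "g = \<mu> ! (i + 1)" and "e = \<mu> ! (i + 2)"
    define b c d where "b = lam i" and "c = lam (i + 1)" and "d = lam (i + 2)"
    note abbrs = a_def f_def g_def e_def b_def c_def d_def
    have len: "length \<mu> = Suc L" and e: "e \<in> chan g d"
      using True i by (auto simp: path_basis_iff abbrs dest: bspec[of _ _ "i + 2"])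
    define w where "w = (\<lambda>z. Poly_Mapping.lookup v (\<mu>[i := z]))"
    \<comment> \<open>At fixed neighbours the projection has rank one at site \<open>i\<close>:
      \<open>S\<close> is the pairing with its row, independent of the outgoing label.\<close>
    define S where "S = (\<Sum>z\<in>chan a b. F a b c g z \<nu> * w z)"
    have pv: "Poly_Mapping.lookup ?pv \<mu> = Fbar a b c g \<nu> f * S"
      using i by (simp add: lookup_proj[OF assms(1) v] abbrs w_def S_def sum_distrib_left)
    have inner: "Poly_Mapping.lookup ?pv (\<mu>[i := x, i + 1 := y])
        = (\<Sum>z\<in>chan a b. Fbar a b c y \<nu> x * (F a b c y z \<nu> * Poly_Mapping.lookup v (\<mu>[i + 1 := y, i := z])))"
      for x y
      using i len by (simp add: lookup_proj[OF assms(1) v] abbrs list_update_swap[of i "Suc i"])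
    have "Poly_Mapping.lookup ?lhs \<mu> = (\<Sum>x\<in>chan a b. Fbar a b c g \<nu> f * (F a b c g x \<nu> *
        (\<Sum>y\<in>chan x c. Fbar x c d e \<nu>' g * (F x c d e y \<nu>' *
          Poly_Mapping.lookup ?pv (\<mu>[i := x, i + 1 := y])))))"
      using i len by (simp add: lookup_proj[OF assms(1) proj_in_path_module] abbrs)
    also have "\<dots> = (\<Sum>x\<in>chan a b. Fbar a b c g \<nu> f * (F a b c g x \<nu> *
        (Fbar x c d e \<nu>' g * (F x c d e g \<nu>' * (Fbar a b c g \<nu> x * S)))))"
    proof (intro sum.cong refl)
      fix x
      \<comment> \<open>The outer factor is included because it gives
        \<open>g \<in> chan a \<nu>\<close>, while the inner projection gives
        \<open>y \<in> chan a \<nu>\<close>. Both labels fuse with \<open>d\<close> to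
        \<open>e\<close>, so they coincide: the middle projection acts diagonally.\<close>
      have "Fbar a b c g \<nu> f * (Fbar x c d e \<nu>' g * (F x c d e y \<nu>' *
          Poly_Mapping.lookup ?pv (\<mu>[i := x, i + 1 := y]))) = 0" if "y \<noteq> g" for y
      proof (rule ccontr)
        assume "\<not> ?thesis"
        then have "Fbar a b c g \<nu> f \<noteq> 0" "F x c d e y \<nu>' \<noteq> 0"
          and "Poly_Mapping.lookup ?pv (\<mu>[i := x, i + 1 := y]) \<noteq> 0"
          by auto
        moreover from this(3) have "\<exists>z. Fbar a b c y \<nu> x \<noteq> 0"
          unfolding inner by (auto elim!: sum.not_neutral_contains_not_neutral)
        ultimately have "y \<in> chan a \<nu>" "e \<in> chan y d" "g \<in> chan a \<nu>"
          by (auto dest!: mult_not_zero F_neq_0D Fbar_neq_0D)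
        then have "y = g"
          using middle_unique[OF chan[folded d_def]] e by blast
        with that show False by simp
      qed
      then have "(\<Sum>y\<in>chan x c. Fbar a b c g \<nu> f * (Fbar x c d e \<nu>' g * (F x c d e y \<nu>' *
            Poly_Mapping.lookup ?pv (\<mu>[i := x, i + 1 := y]))))
          = Fbar a b c g \<nu> f * (Fbar x c d e \<nu>' g * (F x c d e g \<nu>' *
            Poly_Mapping.lookup ?pv (\<mu>[i := x, i + 1 := g])))"
        by (intro sum_eq_single) auto
      moreover have "Poly_Mapping.lookup ?pv (\<mu>[i := x, i + 1 := g]) = Fbar a b c g \<nu> x * S"
        unfolding inner by (simp add: g_def S_def w_def sum_distrib_left)
      ultimately show "Fbar a b c g \<nu> f * (F a b c g x \<nu> *
          (\<Sum>y\<in>chan x c. Fbar x c d e \<nu>' g * (F x c d e y \<nu>' *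
            Poly_Mapping.lookup ?pv (\<mu>[i := x, i + 1 := y]))))
        = Fbar a b c g \<nu> f * (F a b c g x \<nu> *
          (Fbar x c d e \<nu>' g * (F x c d e g \<nu>' * (Fbar a b c g \<nu> x * S))))"
        by (simp add: sum_distrib_left[symmetric] mult.left_commute[of _ "F a b c g x \<nu>"])
    qed
    also have "\<dots> = Fbar a b c g \<nu> f * S * (\<Sum>x\<in>chan a b.
        (F a b c g x \<nu> * Fbar x c d e \<nu>' g) * (F x c d e g \<nu>' * Fbar a b c g \<nu> x))"
      by (simp add: sum_distrib_left ac_simps)
    also have "\<dots> = Poly_Mapping.lookup (scale_vec ?\<kappa> ?pv) \<mu>"
    \<comment> \<open>Otherwise \<open>Fbar a b c g \<nu> f\<close> is zero and both sides
      vanish.\<close>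
    proof (cases "g \<in> chan a \<nu>")
      case True
      then show ?thesis
        using loop_left[OF chan[folded d_def] True e, of b c \<nu>']
        by (simp add: lookup_scale_vec pv b_def c_def d_def mult.commute)
    qed (simp add: lookup_scale_vec pv)
    finally show ?thesis .
  qed
qed

lemma proj_right:
  assumes "finite I0" and v: "v \<in> path_module N I0 lam L" and i: "2 \<le> i" "i + 1 \<le> L"
    and chan: "chan (lam (i - 1)) \<nu> = {\<phi>}"
  shows "proj N F Fbar I0 lam L \<nu> i (proj N F Fbar I0 lam L \<nu>' (i - 1) (proj N F Fbar I0 lam L \<nu> i v))
    = scale_vec (F (lam (i - 1)) (lam i) (lam (i + 1)) \<phi> \<nu>' \<nu> *
        Fbar (lam (i - 1)) (lam i) (lam (i + 1)) \<phi> \<nu> \<nu>') (proj N F Fbar I0 lam L \<nu> i v)"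
    (is "?lhs = scale_vec ?\<kappa> ?pv")
proof (rule poly_mapping_eqI)
  fix \<mu>
  \<comment> \<open>The neighbouring site \<open>i - 1\<close> is named \<open>m\<close> to avoid
    truncated subtraction.\<close>
  obtain m where m: "i = Suc m" "1 \<le> m"
    using i by (cases i) auto
  show "Poly_Mapping.lookup ?lhs \<mu> = Poly_Mapping.lookup (scale_vec ?\<kappa> ?pv) \<mu>"
  proof (cases "\<mu> \<in> path_basis N I0 lam L")
    case False
    then show ?thesis
      by (simp add: lookup_scale_vec lookup_path_module_eq_0[OF proj_in_path_module])
  next
    case True
    define a f g e where "a = \<mu> ! (m - 1)" and "f = \<mu> ! m" and "g = \<mu> ! i" and "e = \<mu> ! (i + 1)"
    define b c d where "b = lam m" and "c = lam i" and "d = lam (i + 1)"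
    note abbrs = a_def f_def g_def e_def b_def c_def d_def
    have len: "length \<mu> = Suc L" and f: "f \<in> chan a b"
      using True i m by (auto simp: path_basis_iff abbrs dest: bspec[of _ _ m])
    have b: "lam (i - 1) = b"
      using m by (simp add: b_def)
    note chan' = chan[unfolded b]
    define w where "w = (\<lambda>z. Poly_Mapping.lookup v (\<mu>[i := z]))"
    define S where "S = (\<Sum>z\<in>chan f c. F f c d e z \<nu> * w z)"
    have pv: "Poly_Mapping.lookup ?pv \<mu> = Fbar f c d e \<nu> g * S"
      using i m by (simp add: lookup_proj[OF assms(1) v] abbrs w_def S_def sum_distrib_left)
    have inner: "Poly_Mapping.lookup ?pv (\<mu>[i := x, m := y])
        = (\<Sum>z\<in>chan y c. Fbar y c d e \<nu> x * (F y c d e z \<nu> * Poly_Mapping.lookup v (\<mu>[m := y, i := z])))"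
      for x y
      using i m len by (simp add: lookup_proj[OF assms(1) v] abbrs list_update_swap[of m "Suc m"])
    have "Poly_Mapping.lookup ?lhs \<mu> = (\<Sum>x\<in>chan f c. Fbar f c d e \<nu> g * (F f c d e x \<nu> *
        (\<Sum>y\<in>chan a b. Fbar a b c x \<nu>' f * (F a b c x y \<nu>' *
          Poly_Mapping.lookup ?pv (\<mu>[i := x, m := y])))))"
      using i m len by (simp add: lookup_proj[OF assms(1) proj_in_path_module] abbrs)
    also have "\<dots> = (\<Sum>x\<in>chan f c. Fbar f c d e \<nu> g * (F f c d e x \<nu> *
        (Fbar a b c x \<nu>' f * (F a b c x f \<nu>' * (Fbar f c d e \<nu> x * S)))))"
    proof (intro sum.cong refl)
      fix x
      \<comment> \<open>Here \<open>f\<close> and \<open>y\<close> both lie in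
        \<open>chan a b\<close> and fuse with \<open>\<nu>\<close> to \<open>e\<close>, by the outer
        and inner projection respectively; as \<open>chan b \<nu>\<close> is a singleton, they
        agree.\<close>
      have "Fbar f c d e \<nu> g * (Fbar a b c x \<nu>' f * (F a b c x y \<nu>' *
          Poly_Mapping.lookup ?pv (\<mu>[i := x, m := y]))) = 0" if "y \<noteq> f" for y
      proof (rule ccontr)
        assume "\<not> ?thesis"
        then have "Fbar f c d e \<nu> g \<noteq> 0" "F a b c x y \<nu>' \<noteq> 0"
          and "Poly_Mapping.lookup ?pv (\<mu>[i := x, m := y]) \<noteq> 0"
          by auto
        moreover from this(3) have "\<exists>z. Fbar y c d e \<nu> x \<noteq> 0"
          unfolding inner by (auto elim!: sum.not_neutral_contains_not_neutral)
        ultimately have "y \<in> chan a b" "e \<in> chan y \<nu>" "e \<in> chan f \<nu>"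
          by (auto dest!: F_neq_0D Fbar_neq_0D)
        then have "y = f"
          using middle_unique[OF chan'] f by blast
        with that show False by simp
      qed
      then have "(\<Sum>y\<in>chan a b. Fbar f c d e \<nu> g * (Fbar a b c x \<nu>' f * (F a b c x y \<nu>' *
            Poly_Mapping.lookup ?pv (\<mu>[i := x, m := y]))))
          = Fbar f c d e \<nu> g * (Fbar a b c x \<nu>' f * (F a b c x f \<nu>' *
            Poly_Mapping.lookup ?pv (\<mu>[i := x, m := f])))"
        by (intro sum_eq_single) auto
      moreover have "Poly_Mapping.lookup ?pv (\<mu>[i := x, m := f]) = Fbar f c d e \<nu> x * S"
        unfolding inner by (simp add: f_def S_def w_def sum_distrib_left)
      ultimately show "Fbar f c d e \<nu> g * (F f c d e x \<nu> *
          (\<Sum>y\<in>chan a b. Fbar a b c x \<nu>' f * (F a b c x y \<nu>' *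
            Poly_Mapping.lookup ?pv (\<mu>[i := x, m := y]))))
        = Fbar f c d e \<nu> g * (F f c d e x \<nu> *
          (Fbar a b c x \<nu>' f * (F a b c x f \<nu>' * (Fbar f c d e \<nu> x * S))))"
        by (simp add: sum_distrib_left[symmetric] mult.left_commute[of _ "F f c d e x \<nu>"])
    qed
    also have "\<dots> = Fbar f c d e \<nu> g * S * (\<Sum>x\<in>chan f c.
        (F f c d e x \<nu> * Fbar a b c x \<nu>' f) * (F a b c x f \<nu>' * Fbar f c d e \<nu> x))"
      by (simp add: sum_distrib_left ac_simps)
    also have "\<dots> = Poly_Mapping.lookup (scale_vec ?\<kappa> ?pv) \<mu>"
    proof (cases "e \<in> chan f \<nu>")
      case True
      then show ?thesis
        using loop_right[OF chan' f True, of c d \<nu>']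
        by (simp only: lookup_scale_vec pv b c_def[symmetric] d_def[symmetric] mult.commute)
    qed (simp add: lookup_scale_vec pv)
    finally show ?thesis .
  qed
qed

end

theorem corollary2p1p5:
  fixes N :: "'i \<Rightarrow> 'i \<Rightarrow> 'i \<Rightarrow> nat"
    and F Fbar :: "'i \<Rightarrow> 'i \<Rightarrow> 'i \<Rightarrow> 'i \<Rightarrow> 'i \<Rightarrow> 'i \<Rightarrow> 'r::comm_ring_1"
    and I0 :: "'i set" and lam :: "nat \<Rightarrow> 'i" and L :: nat and \<nu> :: 'i
  assumes "semisimple_tensor_system N F Fbar"
    and "finite I0"
  shows "(\<forall>i. 1 \<le> i \<and> i + 2 \<le> L \<and> acts_onedim_left N \<nu> (lam (i + 2)) \<longrightarrow>
            (\<forall>\<nu>'. \<forall>v \<in> path_module N I0 lam L.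
               proj N F Fbar I0 lam L \<nu> i
                 (proj N F Fbar I0 lam L \<nu>' (i + 1)
                   (proj N F Fbar I0 lam L \<nu> i v)) =
               scale_vec
                 (F (lam i) (lam (i + 1)) (lam (i + 2)) (phi_left N \<nu> (lam (i + 2))) \<nu> \<nu>' *
                  Fbar (lam i) (lam (i + 1)) (lam (i + 2)) (phi_left N \<nu> (lam (i + 2))) \<nu>' \<nu>)
                 (proj N F Fbar I0 lam L \<nu> i v)))
       \<and> (\<forall>i. 2 \<le> i \<and> i + 1 \<le> L \<and> acts_onedim_right N \<nu> (lam (i - 1)) \<longrightarrow>
            (\<forall>\<nu>'. \<forall>v \<in> path_module N I0 lam L.
               proj N F Fbar I0 lam L \<nu> i
                 (proj N F Fbar I0 lam L \<nu>' (i - 1)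
                   (proj N F Fbar I0 lam L \<nu> i v)) =
               scale_vec
                 (F (lam (i - 1)) (lam i) (lam (i + 1)) (phi_right N \<nu> (lam (i - 1))) \<nu>' \<nu> *
                  Fbar (lam (i - 1)) (lam i) (lam (i + 1)) (phi_right N \<nu> (lam (i - 1))) \<nu> \<nu>')
                 (proj N F Fbar I0 lam L \<nu> i v)))"
proof -
  interpret semisimple_tensor_system N F Fbar by (rule assms(1))
  show ?thesis
    using proj_left[OF assms(2)] proj_right[OF assms(2)] chan_onedim_left chan_onedim_right
    by blast
qed

end
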